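(* In the MISO system described in the context, with device set $\mathcal{K}=\{1,\dots,K\}$, the MSE is lower bounded by $$\mathrm{MSE^{lb}}=\frac{\sigma^{2}}{\left(\sum_{i=1}^{K}\sqrt{P_i}\,\|\boldsymbol{h}_i\|\right)^{2}}.$$ Denoting the MSE obtained with and without considering the dynamic learning rate (DLR) by $\mathrm{MSE^{d}}$ and $\mathrm{MSE^{n}}$ respectively, we always have $$\mathrm{MSE^{n}}\overset{(a)}{\ge}\mathrm{MSE^{d}}\overset{(b)}{\ge}\mathrm{MSE^{lb}},$$ where equality (a) holds if and only if $\sqrt{P_i}\|\boldsymbol{h}_i\|=\sqrt{P_j}\|\boldsymbol{h}_j\|$ for all $i,j\in\mathcal{K}$, and equality (b) holds if and only if $r_i\sqrt{P_i}\|\boldsymbol{h}_i\|=r_j\sqrt{P_j}\|\boldsymbol{h}_j\|$ for all $i,j\in\mathcal{K}$.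
   Context: MISO over-the-air computation for federated learning: $K$ devices, each with $N_d$ antennas, transmit to a single-antenna aggregator. $\boldsymbol{h}_k\in\mathbb{C}^{N_d}$ is the channel vector of device $k$, $P_k$ its maximum transmit power, $\sigma^2$ the noise power, and $\|\cdot\|$ the Euclidean norm. $r_k=\mu_k/\mu$ is the DLR ratio of device $k$ (local learning rate over global learning rate). The transmit vectors and the scaling factor are chosen so that the fading-induced error is eliminated under the power constraints; the residual mean square error as a function of the ratios is then $$\mathrm{MSE}=\sigma^2\max_{k\in\mathcal{K}}\frac{1}{K^2P_k r_k^2\|\boldsymbol{h}_k\|^2}.$$ With DLR, the ratios are chosen to minimize this quantity subject to $\sum_{k=1}^K\frac{1}{K r_k}=1$ and $r_k\in[r_{\min},r_{\max}]$ for all $k$, where $r_{\min}$ and $r_{\max}$ are prescribed lower and upper boundaries of the ratios. $\mathrm{MSE^{d}}$ is the MSE so obtained, and the $r_k$ in the condition for (b) are the corresponding ratios. $\mathrm{MSE^{n}}$ is the MSE without DLR, i.e. with all $r_k=1$.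
   Formalization: The formal statement assumes r_min < 1 < r_max (if either equals 1, all ratios must be 1 and "only if" in (a) fails for unequal channels), positive noise power (else all MSEs are 0), and, so that the MSE is defined, K ≥ 1, P_k > 0, nonzero channels and r_min > 0. *)

theory Defs
  imports "HOL-Analysis.Analysis"
begin

text \<open>The devices are \<open>1, \<dots>, K\<close>. Device \<open>k\<close> has maximum transmit power \<open>P k\<close> and channel
  vector \<open>h k\<close> with one complex entry per antenna, so the index type \<open>'n\<close> has \<open>N\<^sub>d\<close> elements;
  \<open>norm\<close> on \<^typ>\<open>complex ^ 'n\<close> is the Euclidean norm. \<open>\<sigma>\<^sup>2\<close> is the noise power and \<open>r k\<close> is
  the ratio of the local learning rate of device \<open>k\<close> to the global learning rate. Values of
  \<open>P\<close>, \<open>h\<close>, \<open>r\<close> outside \<open>{1..K}\<close> play no role.\<close>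

definition mse ::
    "nat \<Rightarrow> (nat \<Rightarrow> real) \<Rightarrow> (nat \<Rightarrow> complex ^ 'n) \<Rightarrow> real \<Rightarrow> (nat \<Rightarrow> real) \<Rightarrow> real" where
  "mse K P h \<sigma> r =
     \<sigma>\<^sup>2 * (MAX k\<in>{1..K}. 1 / ((real K)\<^sup>2 * P k * (r k)\<^sup>2 * (norm (h k))\<^sup>2))"

definition feasible_ratios :: "nat \<Rightarrow> real \<Rightarrow> real \<Rightarrow> (nat \<Rightarrow> real) set" where
  "feasible_ratios K r_min r_max =
     {r. (\<Sum>k=1..K. 1 / (real K * r k)) = 1 \<and> (\<forall>k\<in>{1..K}. r k \<in> {r_min..r_max})}"

definition dlr_ratios ::
    "nat \<Rightarrow> (nat \<Rightarrow> real) \<Rightarrow> (nat \<Rightarrow> complex ^ 'n) \<Rightarrow> real \<Rightarrow> real \<Rightarrow> real \<Rightarrow> (nat \<Rightarrow> real) \<Rightarrow> bool" where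
  "dlr_ratios K P h \<sigma> r_min r_max r \<longleftrightarrow>
     is_arg_min (mse K P h \<sigma>) (\<lambda>r. r \<in> feasible_ratios K r_min r_max) r"

definition mse_dlr ::
    "nat \<Rightarrow> (nat \<Rightarrow> real) \<Rightarrow> (nat \<Rightarrow> complex ^ 'n) \<Rightarrow> real \<Rightarrow> real \<Rightarrow> real \<Rightarrow> real" where
  "mse_dlr K P h \<sigma> r_min r_max = (INF r\<in>feasible_ratios K r_min r_max. mse K P h \<sigma> r)"

definition mse_no_dlr ::
    "nat \<Rightarrow> (nat \<Rightarrow> real) \<Rightarrow> (nat \<Rightarrow> complex ^ 'n) \<Rightarrow> real \<Rightarrow> real" where
  "mse_no_dlr K P h \<sigma> = mse K P h \<sigma> (\<lambda>_. 1)"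

definition mse_lb ::
    "nat \<Rightarrow> (nat \<Rightarrow> real) \<Rightarrow> (nat \<Rightarrow> complex ^ 'n) \<Rightarrow> real \<Rightarrow> real" where
  "mse_lb K P h \<sigma> = \<sigma>\<^sup>2 / (\<Sum>i=1..K. sqrt (P i) * norm (h i))\<^sup>2"

end

theory Submission
  imports Defs
begin

text \<open>Put \<open>a\<^sub>k = \<surd>P\<^sub>k \<parallel>h\<^sub>k\<parallel>\<close> and \<open>u\<^sub>k = 1 / (K r\<^sub>k)\<close>. The ratio constraint says that the \<open>u\<^sub>k\<close>
  sum to \<open>1\<close>, and the error is \<open>\<sigma>\<^sup>2 (max\<^sub>k u\<^sub>k / a\<^sub>k)\<^sup>2\<close>. A maximum of quotients dominates their
  mediant \<open>\<Sum>u / \<Sum>a\<close>, with equality only for constant quotients; this is the lower bound and (b).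
  A minimizer is obtained by clipping \<open>t a\<^sub>k\<close> to the admissible interval, with \<open>t\<close> chosen by the
  intermediate value theorem. For (a), moving \<open>u = 1/K\<close> slightly towards \<open>a / \<Sum>a\<close>
  keeps it admissible and strictly lowers the maximum unless the lower bound is already attained.\<close>

lemma mediant_le_Max:
  fixes u a :: "'i \<Rightarrow> real"
  assumes I: "finite I" "I \<noteq> {}" and a: "\<forall>i\<in>I. 0 < a i"
  shows "sum u I / sum a I \<le> (MAX i\<in>I. u i / a i)"
proof -
  define c where "c = (MAX i\<in>I. u i / a i)"
  have "u i \<le> c * a i" if "i \<in> I" for i
  proof -
    have "u i / a i \<le> c" unfolding c_def using I that by (intro Max_ge) auto
    then show ?thesis using a[rule_format, OF that] by (simp add: field_simps)
  qed
  then have "sum u I \<le> c * sum a I" by (simp add: sum_distrib_left sum_mono)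
  moreover have "0 < sum a I" using I a by (simp add: sum_pos)
  ultimately show ?thesis unfolding c_def[symmetric] by (simp add: divide_le_eq)
qed

text \<open>The bounds \<open>u i \<le> ?c * a i\<close> add up to the mediant inequality, so
  equality of the sums forces equality in every term and each quotient equals \<open>?c\<close>.
  Conversely a common quotient \<open>q\<close> gives \<open>u j = q * a j\<close>, whose mediant is
  again \<open>q\<close>.\<close>

lemma mediant_eq_Max_iff:
  fixes u a :: "'i \<Rightarrow> real"
  assumes I: "finite I" "I \<noteq> {}" and a: "\<forall>i\<in>I. 0 < a i"
  shows "(MAX i\<in>I. u i / a i) = sum u I / sum a I \<longleftrightarrow> (\<forall>i\<in>I. \<forall>j\<in>I. u i / a i = u j / a j)"
    (is "?c = _ \<longleftrightarrow> _")
proof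
  have pos: "0 < sum a I" using I a by (simp add: sum_pos)
  {
    assume "?c = sum u I / sum a I"
    then have eq: "(\<Sum>i\<in>I. u i) = (\<Sum>i\<in>I. ?c * a i)"
      using pos unfolding sum_distrib_left[symmetric] by simp
    have "u i \<le> ?c * a i" if "i \<in> I" for i
    proof -
      have "u i / a i \<le> ?c" using I that by (intro Max_ge) auto
      then show ?thesis using a[rule_format, OF that] by (simp add: field_simps)
    qed
    then have "u i = ?c * a i" if "i \<in> I" for i
      using sum_mono_inv[OF eq _ that I(1)] by blast
    then have "u i / a i = ?c" if "i \<in> I" for i
      using a[rule_format, OF that] that by (metis nonzero_mult_div_cancel_right less_irrefl)
    then show "\<forall>i\<in>I. \<forall>j\<in>I. u i / a i = u j / a j" by simp
  next
    assume const: "\<forall>i\<in>I. \<forall>j\<in>I. u i / a i = u j / a j"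
    obtain i where i: "i \<in> I" using I by blast
    have "(\<lambda>j. u j / a j) ` I = {u i / a i}" using const i by blast
    then have c: "?c = u i / a i" by simp
    define q where "q = u i / a i"
    have "u j = q * a j" if "j \<in> I" for j
    proof -
      have "q = u j / a j" unfolding q_def using const i that by blast
      then show ?thesis using a[rule_format, OF that] by simp
    qed
    then have "sum u I = q * sum a I" by (simp add: sum_distrib_left)
    then show "?c = sum u I / sum a I" unfolding c q_def[symmetric] using pos by simp
  }
qed

text \<open>A water-filling argument: the optimal vector follows the ray \<open>t * a i\<close>, on
  which all quotients agree, wherever the box allows it. A competitor with a smaller maximum would
  lie below this vector everywhere and strictly below it somewhere, so its sum would be too
  small.\<close>

lemma min_max_quotient_attained:
  fixes a :: "'i \<Rightarrow> real" and lo hi s :: real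
  assumes I: "finite I" "I \<noteq> {}" and a: "\<forall>i\<in>I. 0 < a i"
    and lo: "0 \<le> lo" "lo \<le> hi" and s: "real (card I) * lo \<le> s" "s \<le> real (card I) * hi"
  obtains u where "\<forall>i\<in>I. u i \<in> {lo..hi}" and "sum u I = s"
    and "\<And>v. \<forall>i\<in>I. v i \<in> {lo..hi} \<Longrightarrow> sum v I = s \<Longrightarrow>
      (MAX i\<in>I. u i / a i) \<le> (MAX i\<in>I. v i / a i)"
proof -
  define clip where "clip t i = min hi (max lo (t * a i))" for t i
  \<comment> \<open>\<open>T\<close> is a level at which even the smallest weight reaches
    \<open>hi\<close>. From level \<open>0\<close> to level \<open>T\<close> the clipped sum thus
    runs continuously from \<open>card I * lo\<close> to \<open>card I * hi\<close>.\<close>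
  define T where "T = hi / Min (a ` I)"
  have m: "0 < Min (a ` I)" using I a by simp
  have "clip T i = hi" if "i \<in> I" for i
  proof -
    have "Min (a ` I) \<le> a i" using I that by simp
    then have "hi * Min (a ` I) \<le> hi * a i" using lo by (simp add: mult_left_mono)
    then have "hi \<le> T * a i" unfolding T_def using m by (simp add: field_simps)
    then show ?thesis by (simp add: clip_def)
  qed
  then have top: "(\<Sum>i\<in>I. clip T i) = real (card I) * hi" by simp
  have bot: "(\<Sum>i\<in>I. clip 0 i) = real (card I) * lo" using lo by (simp add: clip_def)
  have "0 \<le> T" using lo m by (simp add: T_def)
  moreover have "continuous_on {0..T} (\<lambda>t. \<Sum>i\<in>I. clip t i)"
    unfolding clip_def by (intro continuous_intros)
  ultimately obtain t where t: "(\<Sum>i\<in>I. clip t i) = s"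
    using IVT'[of "\<lambda>t. \<Sum>i\<in>I. clip t i" 0 s T] s top bot by auto
  show thesis
  proof (rule that[of "clip t"])
    show "\<forall>i\<in>I. clip t i \<in> {lo..hi}" using lo by (auto simp: clip_def)
    show "sum (clip t) I = s" using t by simp
    fix v assume v: "\<forall>i\<in>I. v i \<in> {lo..hi}" "sum v I = s"
    let ?c = "MAX i\<in>I. clip t i / a i" and ?d = "MAX i\<in>I. v i / a i"
    have d: "v i / a i \<le> ?d" if "i \<in> I" for i using I that by (intro Max_ge) auto
    have "?c \<in> (\<lambda>i. clip t i / a i) ` I" using I by (intro Max_in) auto
    then obtain k where k: "k \<in> I" "?c = clip t k / a k" by auto
    show "?c \<le> ?d"
    proof (rule ccontr)
      assume less: "\<not> ?c \<le> ?d"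
      have vk: "v k < clip t k"
      proof -
        have "v k / a k < clip t k / a k" using d[OF k(1)] less k(2) by linarith
        then show ?thesis using a[rule_format, OF k(1)] by (simp add: divide_less_cancel)
      qed
      \<comment> \<open>Since \<open>lo \<le> v k < clip t k\<close>, the clipping is not at its
        lower end at \<open>k\<close>. Hence \<open>?d < ?c \<le> t\<close>, which puts every
        \<open>v i\<close> below \<open>t * a i\<close> and, by \<open>v i \<le> hi\<close>, below
        its clipped value.\<close>
      then have "clip t k \<le> t * a k"
        using v(1)[rule_format, OF k(1)] by (auto simp: clip_def min_def max_def split: if_splits)
      then have "?c \<le> t" using k a[rule_format, OF k(1)] by (simp add: divide_le_eq)
      then have "?d \<le> t" using less by linarith
      have "v i \<le> clip t i" if i: "i \<in> I" for i
      proof -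
        have "v i / a i \<le> t" using d[OF i] \<open>?d \<le> t\<close> by linarith
        then have "v i \<le> t * a i" using a[rule_format, OF i] by (simp add: divide_le_eq)
        then show ?thesis using v(1)[rule_format, OF i] by (auto simp: clip_def)
      qed
      then have "sum v I < sum (clip t) I"
        using I(1) k(1) vk by (intro sum_strict_mono_ex1) auto
      then show False using v(2) t by simp
    qed
  qed
qed

text \<open>The vector \<open>q * a\<close> with \<open>q\<close> the mediant has the same sum as
  \<open>u\<close> and all its quotients equal to \<open>q\<close>. It may violate the bounds, but a
  short step from the interior point \<open>u\<close> towards it does not, and such a step already
  pulls every quotient below the old maximum.\<close>

lemma interior_quotient_improvement:
  fixes u a :: "'i \<Rightarrow> real" and lo hi :: real
  assumes I: "finite I" "I \<noteq> {}" and a: "\<forall>i\<in>I. 0 < a i"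
    and u: "\<forall>i\<in>I. lo < u i \<and> u i < hi"
    and less: "sum u I / sum a I < (MAX i\<in>I. u i / a i)"
  obtains v where "\<forall>i\<in>I. v i \<in> {lo..hi}" and "sum v I = sum u I"
    and "(MAX i\<in>I. v i / a i) < (MAX i\<in>I. u i / a i)"
proof -
  define q where "q = sum u I / sum a I"
  define w where "w e i = (1 - e) * u i + e * (q * a i)" for e i
  \<comment> \<open>As \<open>w 0 = u\<close> satisfies the bounds strictly, small \<open>e\<close>
    keep each coordinate inside; finiteness of \<open>I\<close> lets one \<open>e\<close> serve all
    of them.\<close>
  have "((\<lambda>e. w e i) \<longlongrightarrow> w 0 i) (at_right 0)" for i
    unfolding w_def by (intro tendsto_intros)
  then have "\<forall>\<^sub>F e in at_right 0. lo < w e i \<and> w e i < hi" if "i \<in> I" for i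
    using u that by (intro eventually_conj order_tendstoD) (auto simp: w_def)
  then have "\<forall>\<^sub>F e in at_right 0. \<forall>i\<in>I. lo < w e i \<and> w e i < hi"
    using I(1) by (simp add: eventually_ball_finite)
  moreover have "\<forall>\<^sub>F e in at_right (0::real). e \<in> {0<..<1}"
    by (intro eventually_at_right_real) simp
  ultimately have "\<forall>\<^sub>F e in at_right 0. e \<in> {0<..<1} \<and> (\<forall>i\<in>I. lo < w e i \<and> w e i < hi)"
    by (rule eventually_conj[rotated])
  then obtain e where "e \<in> {0<..<1}" and w: "\<forall>i\<in>I. lo < w e i \<and> w e i < hi"
    using eventually_happens'[OF trivial_limit_at_right_real] by blast
  then have e: "0 < e" "e < 1" by simp_all
  show thesis
  proof (rule that[of "w e"])
    show "\<forall>i\<in>I. w e i \<in> {lo..hi}" using w by force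
    have "0 < sum a I" using I a by (simp add: sum_pos)
    then have "q * sum a I = sum u I" by (simp add: q_def)
    moreover have "sum (w e) I = (1 - e) * sum u I + e * (q * sum a I)"
      by (simp add: w_def sum.distrib sum_distrib_left)
    ultimately show "sum (w e) I = sum u I" by (simp add: algebra_simps)
    let ?c = "MAX i\<in>I. u i / a i"
    have "w e i / a i < ?c" if i: "i \<in> I" for i
    proof -
      have "w e i / a i = (1 - e) * (u i / a i) + e * q"
        using a[rule_format, OF i] by (simp add: w_def field_simps)
      also have "\<dots> \<le> (1 - e) * ?c + e * q"
        using I i e by (intro add_mono mult_left_mono Max_ge) auto
      also have "\<dots> < (1 - e) * ?c + e * ?c" using less[folded q_def] e by simp
      also have "\<dots> = ?c" by (simp add: left_diff_distrib)
      finally show ?thesis .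
    qed
    then show "(MAX i\<in>I. w e i / a i) < ?c" using I by simp
  qed
qed

text \<open>The quotients are nonnegative, so squaring preserves their order and the maximum of the
  squares is the square of the maximum.\<close>

lemma mse_eq_Max_quotient:
  assumes "K \<ge> 1" and P: "\<forall>k\<in>{1..K}. P k > 0" and r: "\<forall>k\<in>{1..K}. r k > 0"
  shows "mse K P h \<sigma> r =
    \<sigma>\<^sup>2 * (MAX k\<in>{1..K}. 1 / (real K * r k) / (sqrt (P k) * norm (h k)))\<^sup>2"
proof -
  define q where "q k = 1 / (real K * r k) / (sqrt (P k) * norm (h k))" for k
  let ?c = "MAX k\<in>{1..K}. q k"
  have sq: "1 / ((real K)\<^sup>2 * P k * (r k)\<^sup>2 * (norm (h k))\<^sup>2) = (q k)\<^sup>2" if "k \<in> {1..K}" for k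
    using P that by (auto simp: q_def power_mult_distrib power_divide less_imp_le)
  have nonneg: "0 \<le> q k" if "k \<in> {1..K}" for k
    using P r that by (auto simp: q_def less_imp_le)
  have "?c \<in> q ` {1..K}" using \<open>K \<ge> 1\<close> by (intro Max_in) auto
  then obtain k where k: "k \<in> {1..K}" "?c = q k" by (rule imageE)
  have "q j \<le> q k" if "j \<in> {1..K}" for j
    unfolding k(2)[symmetric] using that by (intro Max_ge) auto
  then have "(MAX k\<in>{1..K}. (q k)\<^sup>2) = (q k)\<^sup>2"
    using nonneg k(1) by (intro Max_eqI) (auto intro!: power_mono)
  moreover have "(MAX k\<in>{1..K}. 1 / ((real K)\<^sup>2 * P k * (r k)\<^sup>2 * (norm (h k))\<^sup>2))
      = (MAX k\<in>{1..K}. (q k)\<^sup>2)"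
    using sq by (intro arg_cong[where f = Max] image_cong) auto
  ultimately show ?thesis unfolding mse_def q_def[symmetric] k(2) by simp
qed

text \<open>The substitution \<open>u = 1 / (K r)\<close> is its own inverse and reverses the order,
  so the ends of the interval trade places. This carries optimal or improved vectors
  \<open>u\<close> back to ratios.\<close>

lemma feasible_ratios_inverse:
  assumes "K \<ge> 1" and "0 < r_min" and "r_min < r_max"
    and u: "\<forall>k\<in>{1..K}. u k \<in> {1 / (real K * r_max)..1 / (real K * r_min)}"
    and sum: "sum u {1..K} = 1"
  shows "(\<lambda>k. 1 / (real K * u k)) \<in> feasible_ratios K r_min r_max"
proof -
  have K: "0 < real K" using \<open>K \<ge> 1\<close> by simp
  have "1 / (real K * (1 / (real K * u k))) = u k" for k using K by simp
  moreover have "1 / (real K * u k) \<in> {r_min..r_max}" if "k \<in> {1..K}" for k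
  proof -
    have "0 < 1 / (real K * r_max)" using K assms(2,3) by simp
    then have pos: "0 < u k" using u[rule_format, OF that] by (meson atLeastAtMost_iff less_le_trans)
    then show ?thesis using u[rule_format, OF that] K assms(2,3) by (auto simp: field_simps)
  qed
  ultimately show ?thesis using sum by (simp add: feasible_ratios_def)
qed

theorem theorem2:
  fixes K :: nat and P :: "nat \<Rightarrow> real" and h :: "nat \<Rightarrow> complex ^ 'n"
    and \<sigma> r_min r_max :: real
  assumes "K \<ge> 1"
    and "\<forall>k\<in>{1..K}. P k > 0"
    and "\<forall>k\<in>{1..K}. h k \<noteq> 0"
    and "\<sigma> > 0"
    and "0 < r_min" and "r_min < 1" and "1 < r_max"
  shows "(\<forall>r\<in>feasible_ratios K r_min r_max. mse K P h \<sigma> r \<ge> mse_lb K P h \<sigma>)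
    \<and> (\<exists>r. dlr_ratios K P h \<sigma> r_min r_max r)
    \<and> mse_no_dlr K P h \<sigma> \<ge> mse_dlr K P h \<sigma> r_min r_max
    \<and> mse_dlr K P h \<sigma> r_min r_max \<ge> mse_lb K P h \<sigma>
    \<and> (mse_no_dlr K P h \<sigma> = mse_dlr K P h \<sigma> r_min r_max \<longleftrightarrow>
         (\<forall>i\<in>{1..K}. \<forall>j\<in>{1..K}. sqrt (P i) * norm (h i) = sqrt (P j) * norm (h j)))
    \<and> (\<forall>r. dlr_ratios K P h \<sigma> r_min r_max r \<longrightarrow>
         (mse_dlr K P h \<sigma> r_min r_max = mse_lb K P h \<sigma> \<longleftrightarrow>
           (\<forall>i\<in>{1..K}. \<forall>j\<in>{1..K}.
              r i * sqrt (P i) * norm (h i) = r j * sqrt (P j) * norm (h j))))"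
proof -
  define a where "a k = sqrt (P k) * norm (h k)" for k
  define u where "u r k = 1 / (real K * r k)" for r :: "nat \<Rightarrow> real" and k
  define c where "c v = (MAX k\<in>{1..K}. v k / a k)" for v :: "nat \<Rightarrow> real"
  define F where "F = feasible_ratios K r_min r_max"
  define lo hi where "lo = 1 / (real K * r_max)" and "hi = 1 / (real K * r_min)"
  have I: "finite {1..K}" "{1..K} \<noteq> {}" using assms(1) by auto
  have K: "0 < real K" using assms(1) by simp
  have a: "\<forall>k\<in>{1..K}. 0 < a k" using assms(2,3) by (simp add: a_def)
  have S: "0 < sum a {1..K}" using I a by (intro sum_pos) auto
  \<comment> \<open>The value \<open>1 / K\<close> belonging to ratio \<open>1\<close> is strictly
    interior. This gives \<open>K * lo \<le> 1 \<le> K * hi\<close>, needed for a minimizer, and the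
    room to move that (a) requires.\<close>
  have lohi: "0 \<le> lo" "lo < 1 / real K" "1 / real K < hi"
    using K assms(5-7) by (auto simp: lo_def hi_def field_simps)
  have rpos: "\<forall>k\<in>{1..K}. r k > 0" if "r \<in> F" for r
    using that assms(5) by (force simp: F_def feasible_ratios_def)
  have usum: "sum (u r) {1..K} = 1" if "r \<in> F" for r
    using that by (simp add: F_def feasible_ratios_def u_def)
  have ubound: "\<forall>k\<in>{1..K}. u r k \<in> {lo..hi}" if "r \<in> F" for r
  proof
    fix k assume "k \<in> {1..K}"
    then have "r_min \<le> r k" "r k \<le> r_max"
      using that by (auto simp: F_def feasible_ratios_def)
    then show "u r k \<in> {lo..hi}" using K assms(5) by (auto simp: u_def lo_def hi_def frac_le)
  qed
  have mse: "mse K P h \<sigma> r = \<sigma>\<^sup>2 * (c (u r))\<^sup>2" if "r \<in> F" for r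
    using mse_eq_Max_quotient[OF assms(1,2) rpos[OF that]] by (simp add: c_def u_def a_def)
  have lb: "mse_lb K P h \<sigma> = \<sigma>\<^sup>2 * (1 / sum a {1..K})\<^sup>2"
    by (simp add: mse_lb_def a_def power_divide)
  have cge: "1 / sum a {1..K} \<le> c (u r)" if "r \<in> F" for r
    using mediant_le_Max[OF I a, of "u r"] usum[OF that] by (simp add: c_def)
  have cpos: "0 < c (u r)" if "r \<in> F" for r
    using cge[OF that] S by (meson less_le_trans zero_less_divide_1_iff)
  have mse_le: "mse K P h \<sigma> r \<le> mse K P h \<sigma> r' \<longleftrightarrow> c (u r) \<le> c (u r')"
    if "r \<in> F" "r' \<in> F" for r r'
    using that assms(4) cpos[OF that(1)] cpos[OF that(2)] by (simp add: mse)
  have bound: "mse_lb K P h \<sigma> \<le> mse K P h \<sigma> r" if "r \<in> F" for r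
    using cge[OF that] S by (simp add: mse[OF that] lb mult_left_mono power_mono)
  have eq_lb: "mse K P h \<sigma> r = mse_lb K P h \<sigma> \<longleftrightarrow>
      (\<forall>i\<in>{1..K}. \<forall>j\<in>{1..K}. r i * sqrt (P i) * norm (h i) = r j * sqrt (P j) * norm (h j))"
    if r: "r \<in> F" for r
  proof -
    have "mse K P h \<sigma> r = mse_lb K P h \<sigma> \<longleftrightarrow> c (u r) = 1 / sum a {1..K}"
      using cpos[OF r] S assms(4) by (simp add: mse[OF r] lb)
    \<comment> \<open>The quotient \<open>u r i / a i\<close> is the reciprocal of
      \<open>K * r i * a i\<close>, so constant quotients amount to constant products
      \<open>r i * a i\<close>.\<close>
    also have "\<dots> \<longleftrightarrow> (\<forall>i\<in>{1..K}. \<forall>j\<in>{1..K}. u r i / a i = u r j / a j)"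
      using mediant_eq_Max_iff[OF I a, of "u r"] usum[OF r] by (simp add: c_def)
    also have "\<dots> \<longleftrightarrow> (\<forall>i\<in>{1..K}. \<forall>j\<in>{1..K}. r i * a i = r j * a j)"
    proof (intro ball_cong refl)
      fix i j assume "i \<in> {1..K}" "j \<in> {1..K}"
      then have "0 < r i" "0 < r j" "0 < a i" "0 < a j" using rpos[OF r] a by auto
      then show "u r i / a i = u r j / a j \<longleftrightarrow> r i * a i = r j * a j"
        using K by (auto simp: u_def field_simps)
    qed
    finally show ?thesis by (simp add: a_def mult.assoc)
  qed
  have inv: "\<exists>r\<in>F. c (u r) = c v"
    if v: "\<forall>k\<in>{1..K}. v k \<in> {lo..hi}" "sum v {1..K} = 1" for v
  proof
    show "(\<lambda>k. 1 / (real K * v k)) \<in> F"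
      unfolding F_def using assms v
      by (intro feasible_ratios_inverse) (auto simp: lo_def hi_def)
    show "c (u (\<lambda>k. 1 / (real K * v k))) = c v"
      using K by (simp add: c_def u_def)
  qed
  have one: "(\<lambda>_. 1) \<in> F" using assms by (simp add: F_def feasible_ratios_def)
  obtain v where v: "\<forall>k\<in>{1..K}. v k \<in> {lo..hi}" "sum v {1..K} = 1"
    and vmin: "\<And>v'. \<forall>k\<in>{1..K}. v' k \<in> {lo..hi} \<Longrightarrow> sum v' {1..K} = 1 \<Longrightarrow> c v \<le> c v'"
    using min_max_quotient_attained[OF I a, of lo hi 1] lohi K unfolding c_def
    by (auto simp: field_simps)
  obtain r0 where r0: "r0 \<in> F" "c (u r0) = c v" using inv[OF v] by blast
  have "mse K P h \<sigma> r0 \<le> mse K P h \<sigma> r" if "r \<in> F" for r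
    using vmin[OF ubound usum] that by (simp add: mse_le r0)
  then have opt0: "dlr_ratios K P h \<sigma> r_min r_max r0"
    using r0(1) by (simp add: dlr_ratios_def is_arg_min_linorder F_def)
  \<comment> \<open>The infimum equals the error at any minimizer; with \<open>r0\<close> at hand,
    bounds on it reduce to bounds on a single feasible error.\<close>
  have dlr: "r \<in> F \<and> mse_dlr K P h \<sigma> r_min r_max = mse K P h \<sigma> r"
    if "dlr_ratios K P h \<sigma> r_min r_max r" for r
    using that unfolding dlr_ratios_def is_arg_min_linorder mse_dlr_def F_def
    by (auto intro!: cInf_eq_minimum)
  have dlr_le: "mse_dlr K P h \<sigma> r_min r_max \<le> mse K P h \<sigma> r" if "r \<in> F" for r
    using opt0 dlr[OF opt0] that by (simp add: dlr_ratios_def is_arg_min_linorder F_def)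
  have dlr_ge: "mse_lb K P h \<sigma> \<le> mse_dlr K P h \<sigma> r_min r_max"
    using dlr[OF opt0] bound by simp
  \<comment> \<open>Constant ratios \<open>1\<close> are optimal only if they reach the lower bound,
    since otherwise they can be improved within \<open>F\<close>. Then (a) is \<open>eq_lb\<close>
    at \<open>r = 1\<close>.\<close>
  have a_iff: "mse_no_dlr K P h \<sigma> = mse_dlr K P h \<sigma> r_min r_max \<longleftrightarrow>
      mse K P h \<sigma> (\<lambda>_. 1) = mse_lb K P h \<sigma>"
  proof
    assume eq: "mse_no_dlr K P h \<sigma> = mse_dlr K P h \<sigma> r_min r_max"
    show "mse K P h \<sigma> (\<lambda>_. 1) = mse_lb K P h \<sigma>"
    proof (rule ccontr)
      assume "mse K P h \<sigma> (\<lambda>_. 1) \<noteq> mse_lb K P h \<sigma>"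
      then have "c (u (\<lambda>_. 1)) \<noteq> 1 / sum a {1..K}" by (auto simp: mse[OF one] lb)
      then have less: "sum (u (\<lambda>_. 1)) {1..K} / sum a {1..K} < c (u (\<lambda>_. 1))"
        using cge[OF one] usum[OF one] by simp
      obtain w where w: "\<forall>k\<in>{1..K}. w k \<in> {lo..hi}"
        "sum w {1..K} = sum (u (\<lambda>_. 1)) {1..K}" "c w < c (u (\<lambda>_. 1))"
        using interior_quotient_improvement[OF I a _ less[unfolded c_def], of lo hi] lohi
        unfolding c_def by (auto simp: u_def)
      obtain r where r: "r \<in> F" "c (u r) = c w" using inv[of w] w usum[OF one] by auto
      then have "mse K P h \<sigma> r < mse K P h \<sigma> (\<lambda>_. 1)"
        using w(3) mse_le[OF one r(1)] by simp
      then show False using dlr_le[OF r(1)] eq by (simp add: mse_no_dlr_def)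
    qed
  next
    assume "mse K P h \<sigma> (\<lambda>_. 1) = mse_lb K P h \<sigma>"
    then show "mse_no_dlr K P h \<sigma> = mse_dlr K P h \<sigma> r_min r_max"
      using dlr_ge dlr_le[OF one] by (simp add: mse_no_dlr_def)
  qed
  show ?thesis
  proof (intro conjI allI impI)
    show "\<forall>r\<in>feasible_ratios K r_min r_max. mse_lb K P h \<sigma> \<le> mse K P h \<sigma> r"
      using bound by (simp add: F_def)
    show "\<exists>r. dlr_ratios K P h \<sigma> r_min r_max r" using opt0 by blast
    show "mse_dlr K P h \<sigma> r_min r_max \<le> mse_no_dlr K P h \<sigma>"
      using dlr_le[OF one] by (simp add: mse_no_dlr_def)
    show "mse_lb K P h \<sigma> \<le> mse_dlr K P h \<sigma> r_min r_max" by (fact dlr_ge)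
    show "mse_no_dlr K P h \<sigma> = mse_dlr K P h \<sigma> r_min r_max \<longleftrightarrow>
         (\<forall>i\<in>{1..K}. \<forall>j\<in>{1..K}. sqrt (P i) * norm (h i) = sqrt (P j) * norm (h j))"
      using a_iff eq_lb[OF one] by simp
    show "mse_dlr K P h \<sigma> r_min r_max = mse_lb K P h \<sigma> \<longleftrightarrow>
           (\<forall>i\<in>{1..K}. \<forall>j\<in>{1..K}.
              r i * sqrt (P i) * norm (h i) = r j * sqrt (P j) * norm (h j))"
      if "dlr_ratios K P h \<sigma> r_min r_max r" for r
      using dlr[OF that] eq_lb by simp
  qed
qed

end
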